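(* Let $\mathcal{A}$ be a unital $C^*$-algebra, let $\mathcal{F}\subseteq\mathcal{A}$ be an ideal of finite type elements, and let $F,D,D'\in B(\mathcal{A})$. If there exist $K_1,K_2\in\mathcal{F}$ such that $$FD=I+K_1,\qquad D'F=I+K_2,$$ where $I$ is the identity operator on $\mathcal{A}$, then $F\in\mathcal{M}\mathcal{K}\Phi(\mathcal{A})$.
   Context: $\mathcal{A}$ is regarded as a right Hilbert $C^*$-module over itself with $\langle x,y\rangle=x^*y$. $B(\mathcal{A})$ is the $C^*$-algebra of bounded $\mathcal{A}$-linear operators on $\mathcal{A}$ (all are adjointable); it is identified with $\mathcal{A}$ via $a\mapsto L_a$ (left multiplication), so elements and ideals of $\mathcal{A}$ are also regarded as elements and ideals of $B(\mathcal{A})$. Ideal of finite type elements: a subalgebra $\mathcal{F}\subseteq\mathcal{A}$ (not assumed closed) such that (i) $\mathcal{F}$ is a selfadjoint two-sided ideal of $\mathcal{A}$; (ii) $\mathcal{F}$ has an approximate unit consisting of projections, i.e. an increasing net $(p_\alpha)$ of projections in $\mathcal{F}$ with $\|p_\alpha a-a\|\to0$ and $\|ap_\alpha-a\|\to0$ for all $a\in\mathcal{F}$; (iii) for all projections $p,q\in\mathcal{F}$ there is $v\in\mathcal{A}$ with $vv^*=q$ and $v^*v\perp p$ (i.e. $v^*v+p$ is a projection). Submodules: $M\tilde\oplus N=\mathcal{A}$ means $M,N$ are closed submodules with $M\cap N=\{0\}$, $M+N=\mathcal{A}$ (not necessarily orthogonal). A closed submodule $N$ of $\mathcal{A}$ is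 complementable if $M\tilde\oplus N=\mathcal{A}$ for some closed submodule $M$; every such $N$ is orthogonally complementable in $\mathcal{A}$, and $P_N\in B(\mathcal{A})$ denotes the orthogonal projection onto $N$. An isomorphism of Hilbert modules is a bounded $\mathcal{A}$-linear bijection. $\mathcal{M}\mathcal{K}\Phi(\mathcal{A})$: $F\in\mathcal{M}\mathcal{K}\Phi(\mathcal{A})$ means that $F\in B(\mathcal{A})$ and there is a decomposition $\mathcal{A}=M_1\tilde\oplus N_1\stackrel{F}{\longrightarrow}M_2\tilde\oplus N_2=\mathcal{A}$ with respect to which $F$ has the matrix $\begin{pmatrix}F_1&0\\0&F_4\end{pmatrix}$ with $F_1$ an isomorphism (i.e. $F$ maps $M_1$ isomorphically onto $M_2$ and $F(N_1)\subseteq N_2$), and such that $P_{N_1},P_{N_2}\in\mathcal{F}$. *)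

theory Defs
  imports "HOL-Analysis.Analysis"
begin

text \<open>
  The underlying real Banach algebra is the library's; the complex structure and the involution
  are added on top of it. The law for the scalar \<^term>\<open>1\<close> follows from
  \<open>scaleR_scaleC\<close>.
\<close>

class cstar_algebra = real_normed_algebra + banach +
  fixes scaleC :: "complex \<Rightarrow> 'a \<Rightarrow> 'a" (infixr "*\<^sub>C" 75)
    and star :: "'a \<Rightarrow> 'a"
  assumes scaleR_scaleC: "r *\<^sub>R x = complex_of_real r *\<^sub>C x"
    and scaleC_add_right: "c *\<^sub>C (x + y) = c *\<^sub>C x + c *\<^sub>C y"
    and scaleC_add_left: "(c + d) *\<^sub>C x = c *\<^sub>C x + d *\<^sub>C x"
    and scaleC_scaleC: "c *\<^sub>C (d *\<^sub>C x) = (c * d) *\<^sub>C x"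
    and mult_scaleC_left: "(c *\<^sub>C x) * y = c *\<^sub>C (x * y)"
    and mult_scaleC_right: "x * (c *\<^sub>C y) = c *\<^sub>C (x * y)"
    and norm_scaleC: "norm (c *\<^sub>C x) = cmod c * norm x"
    and star_star: "star (star x) = x"
    and star_add: "star (x + y) = star x + star y"
    and star_scaleC: "star (c *\<^sub>C x) = cnj c *\<^sub>C star x"
    and star_mult: "star (x * y) = star y * star x"
    and cstar_identity: "norm (star x * x) = (norm x)\<^sup>2"

text \<open>
  A unit is added through \<^class>\<open>monoid_mult\<close> rather than \<^class>\<open>real_normed_algebra_1\<close>, so that
  the zero algebra is not excluded.
\<close>

class unital_cstar_algebra = cstar_algebra + monoid_mult

definition is_projection :: "'a::cstar_algebra \<Rightarrow> bool" where
  "is_projection p \<longleftrightarrow> star p = p \<and> p * p = p"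

definition cstar_le :: "'a::cstar_algebra \<Rightarrow> 'a \<Rightarrow> bool" where
  "cstar_le x y \<longleftrightarrow> (\<exists>c. y - x = star c * c)"

definition directed_preorder :: "'i set \<Rightarrow> ('i \<Rightarrow> 'i \<Rightarrow> bool) \<Rightarrow> bool" where
  "directed_preorder I le \<longleftrightarrow> I \<noteq> {}
     \<and> (\<forall>i\<in>I. le i i)
     \<and> (\<forall>i\<in>I. \<forall>j\<in>I. \<forall>k\<in>I. le i j \<longrightarrow> le j k \<longrightarrow> le i k)
     \<and> (\<forall>i\<in>I. \<forall>j\<in>I. \<exists>k\<in>I. le i k \<and> le j k)"

definition projection_approximate_unit ::
    "'a::cstar_algebra set \<Rightarrow> 'i set \<Rightarrow> ('i \<Rightarrow> 'i \<Rightarrow> bool) \<Rightarrow> ('i \<Rightarrow> 'a) \<Rightarrow> bool" where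
  "projection_approximate_unit \<F> I le p \<longleftrightarrow> directed_preorder I le
     \<and> (\<forall>i\<in>I. p i \<in> \<F> \<and> is_projection (p i))
     \<and> (\<forall>i\<in>I. \<forall>j\<in>I. le i j \<longrightarrow> cstar_le (p i) (p j))
     \<and> (\<forall>a\<in>\<F>. \<forall>\<epsilon>>0. \<exists>i\<in>I. \<forall>j\<in>I. le i j \<longrightarrow>
           norm (p j * a - a) < \<epsilon> \<and> norm (a * p j - a) < \<epsilon>)"

definition selfadjoint_two_sided_ideal :: "'a::cstar_algebra set \<Rightarrow> bool" where
  "selfadjoint_two_sided_ideal \<F> \<longleftrightarrow> 0 \<in> \<F>
     \<and> (\<forall>x\<in>\<F>. \<forall>y\<in>\<F>. x + y \<in> \<F>)
     \<and> (\<forall>c. \<forall>x\<in>\<F>. c *\<^sub>C x \<in> \<F>)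
     \<and> (\<forall>x\<in>\<F>. \<forall>a. a * x \<in> \<F> \<and> x * a \<in> \<F>)
     \<and> (\<forall>x\<in>\<F>. star x \<in> \<F>)"

text \<open>
  HOL cannot quantify existentially over the index type of a net inside a definition, so that type
  is a parameter; a theorem assuming this predicate with a free type variable \<open>'i\<close> covers nets
  over arbitrary directed sets. Being a subalgebra is part of being a two-sided ideal.
\<close>

definition finite_type_ideal :: "'i itself \<Rightarrow> 'a::cstar_algebra set \<Rightarrow> bool" where
  "finite_type_ideal _ \<F> \<longleftrightarrow> selfadjoint_two_sided_ideal \<F>
     \<and> (\<exists>(I :: 'i set) le p. projection_approximate_unit \<F> I le p)
     \<and> (\<forall>p\<in>\<F>. \<forall>q\<in>\<F>. is_projection p \<longrightarrow> is_projection q \<longrightarrow>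
           (\<exists>v. v * star v = q \<and> is_projection (star v * v + p)))"

definition inner_A :: "'a::cstar_algebra \<Rightarrow> 'a \<Rightarrow> 'a" where
  "inner_A x y = star x * y"

definition bounded_module_operators :: "('a::cstar_algebra \<Rightarrow> 'a) set" where
  "bounded_module_operators = {T. bounded_linear T
     \<and> (\<forall>c x. T (c *\<^sub>C x) = c *\<^sub>C T x) \<and> (\<forall>x a. T (x * a) = T x * a)}"

definition left_mult :: "'a::cstar_algebra \<Rightarrow> 'a \<Rightarrow> 'a" where
  "left_mult a = (\<lambda>x. a * x)"

definition closed_submodule :: "'a::cstar_algebra set \<Rightarrow> bool" where
  "closed_submodule N \<longleftrightarrow> closed N \<and> 0 \<in> N
     \<and> (\<forall>x\<in>N. \<forall>y\<in>N. x + y \<in> N)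
     \<and> (\<forall>c. \<forall>x\<in>N. c *\<^sub>C x \<in> N)
     \<and> (\<forall>x\<in>N. \<forall>a. x * a \<in> N)"

definition direct_decomposition :: "'a::cstar_algebra set \<Rightarrow> 'a set \<Rightarrow> bool" where
  "direct_decomposition M N \<longleftrightarrow> closed_submodule M \<and> closed_submodule N
     \<and> M \<inter> N = {0} \<and> {m + n | m n. m \<in> M \<and> n \<in> N} = UNIV"

text \<open>
  Meaningful for orthogonally complementable \<open>N\<close>; there, \<open>orthogonal_projection N x\<close> is the
  component of \<open>x\<close> in \<open>N\<close> with respect to the decomposition into \<open>N\<close> and its orthogonal
  complement.
\<close>

definition orthogonal_projection :: "'a::cstar_algebra set \<Rightarrow> 'a \<Rightarrow> 'a" where
  "orthogonal_projection N x = (THE n. n \<in> N \<and> (\<forall>y\<in>N. inner_A y (x - n) = 0))"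

text \<open>
  Since \<open>F\<close> is already a bounded module operator, its restriction to \<open>M\<^sub>1\<close> is an isomorphism onto
  \<open>M\<^sub>2\<close> precisely when it is a bijection. The image \<open>left_mult ` \<F>\<close> is the ideal \<open>\<F>\<close> regarded
  inside the operators.
\<close>

definition MKPhi :: "'a::cstar_algebra set \<Rightarrow> ('a \<Rightarrow> 'a) set" where
  "MKPhi \<F> = {F. F \<in> bounded_module_operators \<and>
     (\<exists>M\<^sub>1 N\<^sub>1 M\<^sub>2 N\<^sub>2. direct_decomposition M\<^sub>1 N\<^sub>1 \<and> direct_decomposition M\<^sub>2 N\<^sub>2
        \<and> bij_betw F M\<^sub>1 M\<^sub>2 \<and> F ` N\<^sub>1 \<subseteq> N\<^sub>2
        \<and> orthogonal_projection N\<^sub>1 \<in> left_mult ` \<F>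
        \<and> orthogonal_projection N\<^sub>2 \<in> left_mult ` \<F>)}"

end

theory Submission
  imports Defs
begin

text \<open>
  Every module operator is a left multiplication, so \<open>F\<close> becomes an element \<open>f\<close> that is invertible
  modulo \<open>\<F>\<close>. For a projection \<open>p \<in> \<F>\<close> with \<open>\<parallel>k\<^sub>2 (1 - p)\<parallel> < 1\<close> the element \<open>u = 1 + k\<^sub>2 (1 - p)\<close>
  is invertible with inverse in \<open>1 + \<F>\<close>, and \<open>g = (1 - p) u\<inverse> d'\<close> satisfies \<open>g f g = g\<close> and inverts
  \<open>f\<close> modulo \<open>\<F>\<close>. The idempotents \<open>g f\<close> and \<open>f g\<close> then give the two decompositions. The orthogonal
  projection \<open>P\<close> onto the range of an idempotent \<open>q \<in> \<F>\<close> lies in \<open>\<F>\<close> because \<open>P = q P\<close>; explicitly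
  \<open>P = q (1 + q - q\<^sup>*)\<inverse>\<close>.
\<close>

section \<open>Involution, norm of the unit, and invertibility\<close>

lemma star_zero [simp]: "star (0 :: 'a::cstar_algebra) = 0"
  using star_add[of "0 :: 'a" 0] by simp

lemma star_minus: "star (- x) = - star (x :: 'a::cstar_algebra)"
  using star_add[of x "- x"] by (simp add: eq_neg_iff_add_eq_0 add.commute)

lemma star_diff: "star (x - y) = star x - star (y :: 'a::cstar_algebra)"
  using star_add[of x "- y"] by (simp add: star_minus)

lemma star_scaleR: "star (r *\<^sub>R x) = r *\<^sub>R star (x :: 'a::cstar_algebra)"
  by (simp add: scaleR_scaleC star_scaleC)

lemma star_one [simp]: "star (1 :: 'a::unital_cstar_algebra) = 1"
  using star_mult[of "star 1" "1 :: 'a"] by (simp add: star_star)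

text \<open>The C*-identity gives \<open>norm 1 = (norm 1)\<^sup>2\<close>, so the norm is 0 or 1;
  the value 0 occurs in the zero algebra.\<close>

lemma norm_one_le: "norm (1 :: 'a::unital_cstar_algebra) \<le> 1"
  using cstar_identity[of "1 :: 'a"] by (auto simp: power2_eq_square)

lemma star_mult_self_eq_zero: "star x * x = 0 \<Longrightarrow> x = (0 :: 'a::cstar_algebra)"
  using cstar_identity[of x] by simp

text \<open>One-sided inverses are the fixed points of the contractions
  \<open>v \<mapsto> 1 + x * v\<close> and \<open>w \<mapsto> 1 + w * x\<close>; associativity makes
  them equal.\<close>

lemma invertible_one_minus:
  fixes x :: "'a::unital_cstar_algebra"
  assumes "norm x < 1"
  shows "\<exists>v. (1 - x) * v = 1 \<and> v * (1 - x) = 1"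
proof -
  have "\<exists>!v. 1 + x * v = v"
  proof (rule banach_fix_type)
    show "0 \<le> norm x" "norm x < 1" using assms by simp_all
    show "\<forall>a b. dist (1 + x * a) (1 + x * b) \<le> norm x * dist a b"
      using norm_mult_ineq[of x] by (simp add: dist_norm flip: right_diff_distrib)
  qed
  then obtain v where v: "1 + x * v = v" by blast
  have "\<exists>!w. 1 + w * x = w"
  proof (rule banach_fix_type)
    show "0 \<le> norm x" "norm x < 1" using assms by simp_all
    show "\<forall>a b. dist (1 + a * x) (1 + b * x) \<le> norm x * dist a b"
      using norm_mult_ineq[of _ x]
      by (simp add: dist_norm mult.commute[of "norm x"] flip: left_diff_distrib)
  qed
  then obtain w where w: "1 + w * x = w" by blast
  have 1: "(1 - x) * v = 1" using v by (simp add: left_diff_distrib diff_eq_eq)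
  have 2: "w * (1 - x) = 1" using w by (simp add: right_diff_distrib diff_eq_eq)
  have "w = w * ((1 - x) * v)" by (simp add: 1)
  also have "\<dots> = v" using 2 by (simp flip: mult.assoc)
  finally show ?thesis using 1 2 by blast
qed

lemma invertible_one_plus_skew:
  fixes x :: "'a::unital_cstar_algebra"
  assumes skew: "star x = - x"
  shows "\<exists>v. (1 + x) * v = 1 \<and> v * (1 + x) = 1"
proof -
  \<comment> \<open>\<open>\<parallel>x - s\<parallel>\<^sup>2 \<le> \<parallel>x\<parallel>\<^sup>2 + s\<^sup>2 < (1 + s)\<^sup>2\<close> for large \<open>s\<close>, and \<open>1 + x = (1 + s) + (x - s)\<close>.\<close>
  define s where "s = (norm x)\<^sup>2"
  have s: "s \<ge> 0" by (simp add: s_def)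
  define z where "z = s *\<^sub>R 1 - x"
  have "star z * z = (s * s) *\<^sub>R 1 - x * x"
    by (simp add: z_def star_diff star_scaleR skew algebra_simps)
  then have "(norm z)\<^sup>2 = norm ((s * s) *\<^sub>R 1 - x * x)"
    by (metis cstar_identity)
  also have "\<dots> \<le> norm ((s * s) *\<^sub>R (1 :: 'a)) + norm (x * x)" by (rule norm_triangle_ineq4)
  also have "\<dots> \<le> s * s + s"
  proof (rule add_mono)
    show "norm ((s * s) *\<^sub>R (1 :: 'a)) \<le> s * s"
      using mult_left_le[OF norm_one_le, of "s * s"] s by simp
    show "norm (x * x) \<le> s" using norm_mult_ineq[of x x] by (simp add: s_def power2_eq_square)
  qed
  also have "\<dots> < (1 + s)\<^sup>2" using s by (simp add: power2_eq_square algebra_simps)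
  finally have "norm z < 1 + s" using s by (simp add: power2_less_imp_less)
  then have "norm (z /\<^sub>R (1 + s)) < 1" using s by (simp add: field_simps)
  from invertible_one_minus[OF this] obtain v where
    v: "(1 - z /\<^sub>R (1 + s)) * v = 1" "v * (1 - z /\<^sub>R (1 + s)) = 1" by blast
  have "(1 + s) *\<^sub>R (1 - z /\<^sub>R (1 + s)) = (1 + s) *\<^sub>R 1 - z"
    using s by (simp add: scaleR_diff_right)
  then have "1 + x = (1 + s) *\<^sub>R (1 - z /\<^sub>R (1 + s))"
    by (simp add: z_def scaleR_add_left)
  with v s have "(1 + x) * (v /\<^sub>R (1 + s)) = 1 \<and> (v /\<^sub>R (1 + s)) * (1 + x) = 1"
    by simp
  then show ?thesis by blast
qed

section \<open>Orthogonal projections onto ranges of idempotents\<close>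

lemma range_projection_exists:
  fixes q :: "'a::unital_cstar_algebra"
  assumes q: "q * q = q"
  shows "\<exists>P. star P = P \<and> q * P = P \<and> P * q = q"
proof -
  define w where "w = 1 + (q - star q)"
  obtain v where v: "w * v = 1" "v * w = 1"
    using invertible_one_plus_skew[of "q - star q"] by (auto simp: star_diff star_star w_def)
  define P where "P = q * v"
  have qP: "q * P = P" by (simp add: P_def q flip: mult.assoc)
  have Pw: "P * w = q" by (simp add: P_def mult.assoc v)
  have sv: "star v * star w = 1" using arg_cong[OF v(1), of star] by (simp add: star_mult)
  have sq: "star q * star q = star q" using arg_cong[OF q, of star] by (simp add: star_mult)
  \<comment> \<open>Both sides collapse to \<open>star q * q\<close>. Multiplying by
    \<open>star v\<close> and \<open>v\<close> then shows that \<open>q * v\<close> is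
    selfadjoint.\<close>
  have "star w * q = star q * w"
    by (simp add: w_def star_add star_diff star_star q sq algebra_simps)
  then have "star v * (star w * q) * v = star v * (star q * w) * v" by simp
  moreover have "star v * (star w * q) * v = q * v" using sv by (simp flip: mult.assoc)
  moreover have "star v * (star q * w) * v = star v * star q" by (simp add: mult.assoc v)
  ultimately have "q * v = star v * star q" by simp
  then have sP: "star P = P" by (metis P_def star_mult)
  \<comment> \<open>This cancels the terms \<open>P\<close> and \<open>P * star q\<close> in the
    expansion of \<open>P * w = q\<close>.\<close>
  have "P * star q = P" using arg_cong[OF qP, of star] by (simp add: star_mult sP)
  with Pw have "P * q = q" by (simp add: w_def algebra_simps)
  with sP qP show ?thesis by blast
qed

lemma orthogonal_projection_idempotent:
  fixes q :: "'a::unital_cstar_algebra"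
  assumes "q * q = q" and ideal: "selfadjoint_two_sided_ideal \<F>" and "q \<in> \<F>"
  shows "orthogonal_projection {x. q * x = x} \<in> left_mult ` \<F>"
proof -
  obtain P where P: "star P = P" "q * P = P" "P * q = q"
    using range_projection_exists[OF assms(1)] by blast
  have "P \<in> \<F>"
    using ideal \<open>q \<in> \<F>\<close> P(2) unfolding selfadjoint_two_sided_ideal_def by metis
  have orth: "star y * (x - P * x) = 0" if "q * y = y" for x y
  proof -
    have "star y * P = star y"
      using that P by (metis mult.assoc star_mult)
    then show ?thesis by (simp add: right_diff_distrib flip: mult.assoc)
  qed
  have "orthogonal_projection {x. q * x = x} x = P * x" for x
    unfolding orthogonal_projection_def inner_A_def
  proof (rule the_equality)
    show "P * x \<in> {x. q * x = x} \<and> (\<forall>y\<in>{x. q * x = x}. star y * (x - P * x) = 0)"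
      using orth P by (simp flip: mult.assoc)
  next
    fix n assume n: "n \<in> {x. q * x = x} \<and> (\<forall>y\<in>{x. q * x = x}. star y * (x - n) = 0)"
    define y where "y = n - P * x"
    have y: "q * y = y"
      using n P(2) by (simp add: y_def right_diff_distrib flip: mult.assoc)
    \<comment> \<open>For uniqueness, \<open>y\<close> lies in the range of \<open>q\<close> and is
      a difference of two elements orthogonal to that range, so it is orthogonal to itself.\<close>
    have "star y * y = star y * (x - P * x) - star y * (x - n)"
      by (simp add: y_def algebra_simps)
    also have "\<dots> = 0" using n y orth[OF y] by simp
    finally show "n = P * x" using star_mult_self_eq_zero[of y] by (simp add: y_def)
  qed
  then have "orthogonal_projection {x. q * x = x} = left_mult P"
    by (auto simp: left_mult_def)
  with \<open>P \<in> \<F>\<close> show ?thesis by simp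
qed

section \<open>Decompositions given by idempotents\<close>

lemma closed_submodule_idempotent: "closed_submodule {x. q * x = (x :: 'a::cstar_algebra)}"
  unfolding closed_submodule_def
  by (auto simp: distrib_left mult_scaleC_right simp flip: mult.assoc
      intro!: closed_Collect_eq continuous_intros)

lemma direct_decomposition_idempotent:
  fixes q :: "'a::unital_cstar_algebra"
  assumes "q * q = q"
  shows "direct_decomposition {x. q * x = x} {x. (1 - q) * x = x}"
proof -
  have "\<exists>m n. x = m + n \<and> q * m = m \<and> (1 - q) * n = n" for x
  proof (intro exI conjI)
    show "x = q * x + (1 - q) * x" by (simp add: left_diff_distrib)
    show "q * (q * x) = q * x" using assms by (simp flip: mult.assoc)
    then show "(1 - q) * ((1 - q) * x) = (1 - q) * x" by (simp add: algebra_simps)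
  qed
  \<comment> \<open>The second set is the kernel of \<open>q\<close>.\<close>
  moreover have "{x. q * x = x} \<inter> {x. (1 - q) * x = x} = {0}"
    by (auto simp: left_diff_distrib)
  ultimately show ?thesis
    unfolding direct_decomposition_def using closed_submodule_idempotent by auto
qed

text \<open>\<open>f\<close> and \<open>g\<close> are mutually inverse between the ranges of
  \<open>g * f\<close> and \<open>f * g\<close>, and \<open>f\<close> carries the kernel of
  \<open>g * f\<close> into that of \<open>f * g\<close>. These kernels are the ranges of the
  complementary idempotents, which lie in the ideal.\<close>

lemma MKPhi_generalized_inverse:
  fixes f g :: "'a::unital_cstar_algebra"
  assumes F: "F \<in> bounded_module_operators" "F = left_mult f"
    and ideal: "selfadjoint_two_sided_ideal \<F>"
    and gfg: "g * f * g = g"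
    and gf: "1 - g * f \<in> \<F>" and fg: "1 - f * g \<in> \<F>"
  shows "F \<in> MKPhi \<F>"
proof -
  have idem: "(g * f) * (g * f) = g * f" "(f * g) * (f * g) = f * g"
    using gfg by (metis mult.assoc)+
  then have idem': "(1 - g * f) * (1 - g * f) = 1 - g * f" "(1 - f * g) * (1 - f * g) = 1 - f * g"
    by (simp_all add: left_diff_distrib right_diff_distrib)
  have "bij_betw F {x. g * f * x = x} {x. f * g * x = x}"
    by (rule bij_betw_byWitness[where f' = "left_mult g"])
      (auto simp: F(2) left_mult_def mult.assoc)
  moreover have "F ` {x. (1 - g * f) * x = x} \<subseteq> {x. (1 - f * g) * x = x}"
    by (auto simp: F(2) left_mult_def left_diff_distrib mult.assoc)
  ultimately show ?thesis
    unfolding MKPhi_def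
    using F(1) direct_decomposition_idempotent[OF idem(1)] direct_decomposition_idempotent[OF idem(2)]
      orthogonal_projection_idempotent[OF idem'(1) ideal gf]
      orthogonal_projection_idempotent[OF idem'(2) ideal fg]
    by blast
qed

section \<open>From operators to elements, and inversion modulo the ideal\<close>

lemma bounded_module_operator_eq_left_mult:
  fixes T :: "'a::unital_cstar_algebra \<Rightarrow> 'a"
  assumes "T \<in> bounded_module_operators"
  shows "T = left_mult (T 1)"
proof
  fix x
  have "T (1 * x) = T 1 * x" using assms by (auto simp only: bounded_module_operators_def)
  then show "T x = left_mult (T 1) x" by (simp add: left_mult_def)
qed

lemma generalized_inverse_modulo_ideal:
  fixes f d d' :: "'a::unital_cstar_algebra"
  assumes ideal: "selfadjoint_two_sided_ideal \<F>"
    and k: "k\<^sub>1 \<in> \<F>" "k\<^sub>2 \<in> \<F>" and fd: "f * d = 1 + k\<^sub>1" and df: "d' * f = 1 + k\<^sub>2"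
    and p: "p \<in> \<F>" "p * p = p" "norm (k\<^sub>2 * p - k\<^sub>2) < 1"
  shows "\<exists>g. g * f * g = g \<and> 1 - g * f \<in> \<F> \<and> 1 - f * g \<in> \<F>"
proof -
  have add: "x + y \<in> \<F>" if "x \<in> \<F>" "y \<in> \<F>" for x y
    using ideal that by (simp add: selfadjoint_two_sided_ideal_def)
  have mult: "a * x \<in> \<F>" "x * a \<in> \<F>" if "x \<in> \<F>" for x a
    using ideal that by (simp_all add: selfadjoint_two_sided_ideal_def)
  have uminus: "- x \<in> \<F>" if "x \<in> \<F>" for x
    using mult(1)[OF that, of "- 1"] by simp
  have diff: "x - y \<in> \<F>" if "x \<in> \<F>" "y \<in> \<F>" for x y
    using add[OF that(1) uminus[OF that(2)]] by simp
  define r where "r = 1 - p"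
  have rr: "r * r = r" using p(2) by (simp add: r_def algebra_simps)
  define u where "u = 1 + k\<^sub>2 * r"
  have u_eq: "u = 1 - (k\<^sub>2 * p - k\<^sub>2)" by (simp add: u_def r_def right_diff_distrib)
  obtain v where v: "u * v = 1" "v * u = 1"
    using invertible_one_minus[OF p(3)] u_eq by blast
  \<comment> \<open>\<open>1 + k\<^sub>2\<close> and the invertible \<open>u\<close> agree on the
    range of the idempotent \<open>r\<close>, so \<open>v * d'\<close> inverts \<open>f\<close> from
    the left there.\<close>
  have dfr: "d' * f * r = u * r"
    by (simp add: df u_def distrib_right mult.assoc rr)
  define g where "g = r * v * d'"
  have "g * f * g = r * v * (d' * f * r) * v * d'" by (simp add: g_def mult.assoc)
  also have "\<dots> = r * (v * u) * r * v * d'" unfolding dfr by (simp add: mult.assoc)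
  also have "\<dots> = g" by (simp add: v rr g_def)
  finally have gfg: "g * f * g = g" .
  \<comment> \<open>Expanding \<open>u * v = 1\<close> exhibits \<open>1 - v\<close> as a multiple
    of \<open>k\<^sub>2\<close>.\<close>
  have "v + k\<^sub>2 * r * v = 1" using v(1) by (simp add: u_def distrib_right)
  then have "1 - v = k\<^sub>2 * r * v" by (metis add_diff_cancel_left')
  then have v_mem: "1 - v \<in> \<F>" using k mult by simp
  have rv_mem: "1 - r * v \<in> \<F>"
  proof -
    have "1 - r * v = (1 - v) + p * v" by (simp add: r_def left_diff_distrib)
    then show ?thesis using add[OF v_mem mult(2)[OF p(1)]] by metis
  qed
  have gf_mem: "1 - g * f \<in> \<F>"
  proof -
    have "g * f = r * v * (1 + k\<^sub>2)" by (simp add: g_def df[symmetric] mult.assoc)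
    then have "1 - g * f = (1 - r * v) - r * v * k\<^sub>2" by (simp add: distrib_left)
    then show ?thesis using diff[OF rv_mem mult(1)[OF k(2)]] by metis
  qed
  \<comment> \<open>Modulo \<open>\<F>\<close> the left inverse \<open>g\<close> and the right inverse \<open>d\<close> coincide, which turns \<open>g\<close> into a
    right inverse.\<close>
  have fg_mem: "1 - f * g \<in> \<F>"
  proof -
    have "f * g * f * d = f * g + f * g * k\<^sub>1" by (simp add: mult.assoc fd distrib_left)
    then have "f * (1 - g * f) * d = 1 + k\<^sub>1 - (f * g + f * g * k\<^sub>1)"
      by (simp add: left_diff_distrib right_diff_distrib fd flip: mult.assoc)
    then have "1 - f * g = f * (1 - g * f) * d - (k\<^sub>1 - f * g * k\<^sub>1)"
      by simp
    then show ?thesis using gf_mem k mult diff by metis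
  qed
  from gfg gf_mem fg_mem show ?thesis by blast
qed

theorem theorem2p12:
  fixes \<F> :: "'a::unital_cstar_algebra set"
    and F D D' :: "'a \<Rightarrow> 'a"
  assumes "finite_type_ideal TYPE('i) \<F>"
    and "F \<in> bounded_module_operators"
    and "D \<in> bounded_module_operators"
    and "D' \<in> bounded_module_operators"
    and "\<exists>K\<^sub>1 \<in> left_mult ` \<F>. \<exists>K\<^sub>2 \<in> left_mult ` \<F>.
           F \<circ> D = (\<lambda>x. id x + K\<^sub>1 x) \<and> D' \<circ> F = (\<lambda>x. id x + K\<^sub>2 x)"
  shows "F \<in> MKPhi \<F>"
proof -
  from assms(1) obtain I :: "'i set" and le p
    where ideal: "selfadjoint_two_sided_ideal \<F>"
      and unit: "projection_approximate_unit \<F> I le p"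
    unfolding finite_type_ideal_def by blast
  note F = bounded_module_operator_eq_left_mult[OF assms(2)]
  note D' = bounded_module_operator_eq_left_mult[OF assms(4)]
  obtain k\<^sub>1 k\<^sub>2 where k: "k\<^sub>1 \<in> \<F>" "k\<^sub>2 \<in> \<F>"
    and eq: "F \<circ> D = (\<lambda>x. id x + left_mult k\<^sub>1 x)" "D' \<circ> F = (\<lambda>x. id x + left_mult k\<^sub>2 x)"
    using assms(5) by blast
  \<comment> \<open>Evaluating the operator identities at the unit turns them into identities
    between elements.\<close>
  have fd: "F 1 * D 1 = 1 + k\<^sub>1"
    using fun_cong[OF eq(1), of 1] fun_cong[OF F, of "D 1"] by (simp add: left_mult_def)
  have df: "D' 1 * F 1 = 1 + k\<^sub>2"
    using fun_cong[OF eq(2), of 1] fun_cong[OF D', of "F 1"] by (simp add: left_mult_def)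
  \<comment> \<open>The approximate unit is used with tolerance 1, the bound that makes
    \<open>u\<close> invertible.\<close>
  obtain i where i: "i \<in> I" "\<forall>j\<in>I. le i j \<longrightarrow> norm (k\<^sub>2 * p j - k\<^sub>2) < 1"
    using unit k(2) zero_less_one unfolding projection_approximate_unit_def by metis
  have "le i i"
    using unit i(1) unfolding projection_approximate_unit_def directed_preorder_def by blast
  then have "norm (k\<^sub>2 * p i - k\<^sub>2) < 1" using i by blast
  moreover have "p i \<in> \<F>" "p i * p i = p i"
    using unit i(1) unfolding projection_approximate_unit_def is_projection_def by auto
  ultimately obtain g where "g * F 1 * g = g" "1 - g * F 1 \<in> \<F>" "1 - F 1 * g \<in> \<F>"
    using generalized_inverse_modulo_ideal[OF ideal k fd df] by blast
  then show ?thesis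
    by (rule MKPhi_generalized_inverse[OF assms(2) F ideal])
qed

end
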